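(* Let $a,h,d,b$ be positive integers with $b\ge4$ and $\gcd(a,d)=1$, and let $A(a)=(a,ha+d,ha+2d,ha+bd,ha+(b+1)d)$. Suppose either $b$ is odd, $h\ge\left\lceil\frac{2d}{(b-3)(b+1)}\right\rceil$ and $a\ge\frac{(b-3)(b+1)^2}{2}$; or $b$ is even, $h\ge\left\lceil\frac{2d}{(b-2)(b+1)}\right\rceil$ and $a\ge\frac{(b-2)(b+1)^2}{2}$. Then $$g(A(a))=\begin{cases}\left\lfloor\frac{a}{b+1}\right\rfloor(ha+(b+1)d)+(j-1)d-a & \text{if } a\equiv j\in\{0,1\}\pmod{b+1},\\[2pt] \left\lfloor\frac{a}{b+1}\right\rfloor(ha+(b+1)d)+(j-1)d+(h-1)a & \text{if } a\equiv j\in\{2,3,\dots,b\}\pmod{b+1}.\end{cases}$$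
   Context: For positive integers $a_1,\dots,a_n$ with $\gcd=1$, the Frobenius number $g(a_1,\dots,a_n)$ is the largest integer not representable as $\sum x_ia_i$ with nonnegative integers $x_i$. *)

theory Defs
  imports Complex_Main
begin

definition representable :: "nat list \<Rightarrow> int \<Rightarrow> bool" where
  "representable A m \<longleftrightarrow>
     (\<exists>x :: nat \<Rightarrow> nat. m = (\<Sum>i<length A. int (x i) * int (A ! i)))"

(* Integer-valued: the largest non-representable integer is -1 when 1 is a generator.
   The maximum exists for nonempty lists of positive integers with gcd 1. *)
definition frobenius_number :: "nat list \<Rightarrow> int" where
  "frobenius_number A = (GREATEST m :: int. \<not> representable A m)"

end

theory Submission
  imports Defs "HOL-Number_Theory.Cong"
begin

text \<open>
  A sum of \<open>k\<close> generators other than \<open>a\<close> has the form \<open>k h a + s d\<close>, where \<open>s\<close> is a sum of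
  \<open>k\<close> coins from \<open>{1, 2, b, b + 1}\<close>. Let \<open>W = \<lceil>(a - 1) / (b + 1)\<rceil>\<close>. Because \<open>W \<ge> b - 1\<close>, every
  \<open>r \<le> a - 1\<close> is a sum of at most \<open>W\<close> coins, so every residue class modulo \<open>a\<close> contains a
  representable number not exceeding \<open>W h a + (a - 1) d\<close>. In the class of \<open>(a - 1) d\<close> this bound is
  attained: there \<open>s \<equiv> -1\<close> modulo \<open>a\<close>, hence \<open>s \<ge> a - 1\<close>, which needs at least \<open>W\<close> coins.
  The Frobenius number is therefore \<open>W h a + (a - 1) d - a\<close>.
\<close>

text \<open>Start greedily with \<open>q\<close> coins \<open>b + 1\<close> and remainder
  \<open>t\<close>. If \<open>q + t \<ge> b\<close>, the remainder is absorbed by trading coins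
  \<open>b + 1\<close> for coins \<open>b\<close>; otherwise coins 1 and 2 pay for it within the
  bound.\<close>

lemma coin_sum_bounded_count:
  fixes b r W :: nat
  assumes "r \<le> W * (b + 1)" and "b \<le> W + 1"
  obtains y z u v :: nat
  where "r = y + 2 * z + b * u + (b + 1) * v" and "y + z + u + v \<le> W"
proof -
  define q where "q = r div (b + 1)"
  define t where "t = r mod (b + 1)"
  have r: "r = q * (b + 1) + t" and t: "t \<le> b"
    unfolding q_def t_def by (simp_all add: less_Suc_eq_le[symmetric] del: mult_Suc_right)
  consider "t = 0" | "t \<ge> 1" "b \<le> q + t" | "t \<ge> 1" "q + t < b" by linarith
  then show ?thesis
  proof cases
    case 1
    then have "q * (b + 1) \<le> W * (b + 1)" using r assms by simp
    then have "q \<le> W" by (simp only: mult_le_cancel2)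
    with 1 show ?thesis using that[of 0 0 0 q] r by (simp add: algebra_simps)
  next
    case 2
    have "q * (b + 1) < W * (b + 1)" using r assms 2 by linarith
    then have "q < W" by (simp only: mult_less_cancel2)
    obtain i where i: "b = t + i" using t le_Suc_ex by blast
    obtain p where p: "q = i + p" using 2 i le_Suc_ex by (metis add.commute add_le_cancel_left)
    \<comment> \<open>The remainder \<open>b - i\<close> together with \<open>i\<close> coins
      \<open>b + 1\<close> makes \<open>i + 1\<close> coins \<open>b\<close>. The total count is
      \<open>q + 1 \<le> W\<close>.\<close>
    show ?thesis
      using that[of 0 0 "i + 1" p] r i p \<open>q < W\<close> by (simp add: algebra_simps)
  next
    case 3
    have "t = t mod 2 + 2 * (t div 2)" by simp
    then have "r = t mod 2 + 2 * (t div 2) + b * 0 + (b + 1) * q"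
      using r by (simp add: algebra_simps)
    \<comment> \<open>The coins 1 and 2 number at most \<open>t\<close>, and
      \<open>q + t \<le> b - 1 \<le> W\<close>.\<close>
    moreover have "t mod 2 + t div 2 + 0 + q \<le> W" using 3 assms(2) by linarith
    ultimately show ?thesis using that by blast
  qed
qed

lemma representable_five_iff:
  "representable [a, c1, c2, c3, c4] m \<longleftrightarrow>
     (\<exists>x y z u v :: nat. m = int x * int a + int y * int c1 + int z * int c2
                          + int u * int c3 + int v * int c4)"
  (is "?L \<longleftrightarrow> ?R")
proof
  show "?L \<Longrightarrow> ?R"
    unfolding representable_def by (fastforce simp: eval_nat_numeral)
next
  assume ?R
  then obtain x y z u v :: nat where
    "m = int x * int a + int y * int c1 + int z * int c2 + int u * int c3 + int v * int c4"
    by blast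
  then show ?L
    unfolding representable_def
    by (intro exI[of _ "\<lambda>i. [x, y, z, u, v] ! i"]) (simp add: eval_nat_numeral)
qed

text \<open>Since \<open>d\<close> is invertible modulo \<open>a\<close>, take \<open>n\<close>
  times its inverse and reduce modulo \<open>a\<close>.\<close>

lemma residue_multiple:
  fixes a d :: nat and n :: int
  assumes "a > 0" and "gcd a d = 1"
  obtains r :: nat where "r < a" and "int a dvd n - int r * int d"
proof -
  have "coprime (int d) (int a)"
    using assms(2) by (simp add: coprime_iff_gcd_eq_1 gcd.commute)
  then obtain e where e: "[int d * e = 1] (mod int a)"
    using cong_solve_coprime_int by blast
  define r where "r = nat ((n * e) mod int a)"
  have r: "int r = (n * e) mod int a" using assms(1) by (simp add: r_def)
  have "[int r * int d = n * e * int d] (mod int a)"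
    unfolding r by (intro cong_mult) (simp_all add: cong_def)
  also have "n * e * int d = n * (int d * e)" by simp
  also have "[n * (int d * e) = n * 1] (mod int a)"
    by (intro cong_mult e cong_refl)
  finally have "int a dvd n - int r * int d"
    by (simp add: cong_iff_dvd_diff dvd_diff_commute)
  moreover have "int r < int a" using assms(1) by (simp add: r)
  ultimately show ?thesis using that by simp
qed

text \<open>The conditions \<open>up\<close> and \<open>lo\<close> together say that
  \<open>W\<close> is the ceiling of \<open>(a - 1) / (b + 1)\<close>: \<open>up\<close> serves the
  upper bound, \<open>lo\<close> the non-representability of the claimed value.\<close>

lemma frobenius_number_coins:
  fixes a h d b W :: nat
  assumes "a > 0" and "gcd a d = 1" and "b > 0" and "b \<le> W + 1"
    and up: "a - 1 \<le> W * (b + 1)"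
    and lo: "(int W - 1) * (int b + 1) < int a - 1"
  shows "frobenius_number [a, h * a + d, h * a + 2 * d, h * a + b * d, h * a + (b + 1) * d] =
    int W * int h * int a + (int a - 1) * int d - int a"
    (is "frobenius_number ?A = ?G")
  unfolding frobenius_number_def
proof (rule Greatest_equality)
  show "\<not> representable ?A ?G"
  proof
    assume "representable ?A ?G"
    then obtain x y z u v :: nat where
      rep: "?G = int x * int a + int y * int (h * a + d) + int z * int (h * a + 2 * d)
        + int u * int (h * a + b * d) + int v * int (h * a + (b + 1) * d)"
      unfolding representable_five_iff by blast
    define k where "k = y + z + u + v"
    define s where "s = y + 2 * z + b * u + (b + 1) * v"
    have G: "?G = (int x + int k * int h) * int a + int s * int d"
      unfolding rep k_def s_def by (simp add: algebra_simps)
    then have "(int s + 1) * int d = int a * (int W * int h + int d - 1 - int x - int k * int h)"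
      by (simp add: algebra_simps)
    then have "int a dvd (int s + 1) * int d" by simp
    moreover have "coprime (int a) (int d)"
      using assms(2) by (simp add: coprime_iff_gcd_eq_1)
    ultimately have "int a dvd int s + 1" using coprime_dvd_mult_left_iff by blast
    then have s: "int a - 1 \<le> int s" using zdvd_imp_le by force
    \<comment> \<open>No coin exceeds \<open>b + 1\<close>; the extra terms are the shortfalls of
      the coins 1, 2 and \<open>b\<close>.\<close>
    have "k * (b + 1) = s + b * y + (b * z - z) + u"
      using \<open>b > 0\<close> unfolding s_def k_def by (simp add: algebra_simps)
    then have "s \<le> k * (b + 1)" by linarith
    then have "int s \<le> int k * (int b + 1)"
      by (metis of_nat_1 of_nat_add of_nat_le_iff of_nat_mult)
    with s lo have "(int W - 1) * (int b + 1) < int k * (int b + 1)" by linarith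
    then have "int W \<le> int k" by (simp add: mult_less_cancel_right)
    \<comment> \<open>The represented number is thus at least \<open>W h a + (a - 1) d\<close>,
      which is \<open>?G + a\<close>.\<close>
    then have "int W * (int h * int a) \<le> int k * (int h * int a)"
      by (intro mult_right_mono) auto
    moreover have "(int a - 1) * int d \<le> int s * int d" using s by (intro mult_right_mono) auto
    moreover have "0 \<le> int x * int a" by simp
    ultimately show False
      using G \<open>a > 0\<close> unfolding distrib_right mult.assoc by linarith
  qed
next
  fix n :: int
  assume "\<not> representable ?A n"
  show "n \<le> ?G"
  proof (rule ccontr)
    assume n: "\<not> n \<le> ?G"
    obtain r where r: "r < a" "int a dvd n - int r * int d"
      by (rule residue_multiple[OF assms(1,2)])
    have "r \<le> W * (b + 1)" using r(1) up by linarith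
    from this \<open>b \<le> W + 1\<close> obtain y z u v
      where coins: "r = y + 2 * z + b * u + (b + 1) * v"
      and count: "y + z + u + v \<le> W"
      by (rule coin_sum_bounded_count)
    define k where "k = y + z + u + v"
    obtain m where m: "n - int r * int d = int a * m" using r(2) by blast
    have "int k * (int h * int a) \<le> int W * (int h * int a)"
      using count unfolding k_def by (intro mult_right_mono) auto
    moreover have "int r * int d \<le> (int a - 1) * int d"
      using r(1) by (intro mult_right_mono) auto
    \<comment> \<open>The \<open>- a\<close> in \<open>?G\<close> becomes the \<open>+ 1\<close>
      here. By integrality \<open>m \<ge> k h\<close>, and the excess is the number \<open>x\<close>
      of generators \<open>a\<close>.\<close>
    ultimately have "int a * (int k * int h) < int a * (m + 1)"
      using n m by (simp add: algebra_simps)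
    then have "int k * int h < m + 1"
      using \<open>a > 0\<close> by (simp only: mult_less_cancel_left_pos of_nat_0_less_iff)
    then have "m - int k * int h \<ge> 0" by simp
    then obtain x where "m - int k * int h = int x" by (rule nonneg_int_cases)
    then have "m = int x + int k * int h" by simp
    then have "n = int x * int a + int y * int (h * a + d)
        + int z * int (h * a + 2 * d) + int u * int (h * a + b * d)
        + int v * int (h * a + (b + 1) * d)"
      using m unfolding k_def coins by (simp add: algebra_simps)
    then have "representable ?A n" unfolding representable_five_iff by blast
    with \<open>\<not> representable ?A n\<close> show False by blast
  qed
qed

theorem theorem3p7:
  fixes a h d b :: nat
  assumes "a > 0" and "h > 0" and "d > 0" and "b \<ge> 4" and "gcd a d = 1"
    and "(odd b
            \<and> int h \<ge> \<lceil>2 * real d / ((real b - 3) * (real b + 1))\<rceil>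
            \<and> real a \<ge> (real b - 3) * (real b + 1)\<^sup>2 / 2)
         \<or> (even b
            \<and> int h \<ge> \<lceil>2 * real d / ((real b - 2) * (real b + 1))\<rceil>
            \<and> real a \<ge> (real b - 2) * (real b + 1)\<^sup>2 / 2)"
  shows "frobenius_number [a, h * a + d, h * a + 2 * d, h * a + b * d, h * a + (b + 1) * d] =
    (let j = a mod (b + 1) in
     if j \<in> {0, 1}
     then \<lfloor>real a / real (b + 1)\<rfloor> * int (h * a + (b + 1) * d) + (int j - 1) * int d - int a
     else \<lfloor>real a / real (b + 1)\<rfloor> * int (h * a + (b + 1) * d) + (int j - 1) * int d
            + (int h - 1) * int a)"
proof -
  define Q where "Q = a div (b + 1)"
  define j where "j = a mod (b + 1)"
  \<comment> \<open>As \<open>a - 1 = Q (b + 1) + (j - 1)\<close>, this is the ceiling of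
    \<open>(a - 1) / (b + 1)\<close>; it produces the case split of the formula.\<close>
  define W where "W = (if j \<in> {0, 1} then Q else Q + 1)"
  have a: "a = Q * (b + 1) + j" unfolding Q_def j_def by (simp only: div_mult_mod_eq)
  then have int_a: "int a = int Q * (int b + 1) + int j" by (simp add: algebra_simps)
  have "j < b + 1" unfolding j_def by simp
  have floor: "\<lfloor>real a / real (b + 1)\<rfloor> = int Q"
    unfolding Q_def by (simp only: floor_divide_of_nat_eq)
  \<comment> \<open>Both parity cases give this bound, which means \<open>Q \<ge> b - 1\<close> and
    hence \<open>b \<le> W + 1\<close>.\<close>
  have "(real b - 1) * (real b + 1) \<le> real a"
    using assms(6)
  proof (elim disjE conjE)
    assume "odd b" and *: "real a \<ge> (real b - 3) * (real b + 1)\<^sup>2 / 2"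
    \<comment> \<open>Oddness excludes \<open>b = 4\<close>, where \<open>2 (b - 1) = 6\<close>
      exceeds \<open>(b - 3) (b + 1) = 5\<close>.\<close>
    then have "b \<ge> 5" using \<open>b \<ge> 4\<close> by (cases "b = 4") auto
    then have "0 \<le> (real b - 5) * (real b + 1)" by simp
    then have "2 * (real b - 1) \<le> (real b - 3) * (real b + 1)" by (simp add: algebra_simps)
    then have "2 * (real b - 1) * (real b + 1) \<le> (real b - 3) * (real b + 1) * (real b + 1)"
      by (intro mult_right_mono) auto
    with * show ?thesis by (simp only: power2_eq_square mult.assoc)
  next
    assume *: "real a \<ge> (real b - 2) * (real b + 1)\<^sup>2 / 2"
    have "2 * (real b + 1) \<le> (real b - 2) * (real b + 1)"
      using \<open>b \<ge> 4\<close> by (intro mult_right_mono) auto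
    then have "2 * (real b - 1) \<le> (real b - 2) * (real b + 1)"
      by (rule order_trans[rotated]) simp
    then have "2 * (real b - 1) * (real b + 1) \<le> (real b - 2) * (real b + 1) * (real b + 1)"
      by (intro mult_right_mono) auto
    with * show ?thesis by (simp only: power2_eq_square mult.assoc)
  qed
  then have "real ((b - 1) * (b + 1)) \<le> real a" using \<open>b \<ge> 4\<close> by (simp add: of_nat_diff algebra_simps)
  then have "(b - 1) * (b + 1) \<le> a" by (simp only: of_nat_le_iff)
  then have "b - 1 \<le> Q" unfolding Q_def by (simp add: less_eq_div_iff_mult_less_eq)
  then have "b \<le> W + 1" unfolding W_def by auto
  moreover have "a - 1 \<le> W * (b + 1)"
    using a \<open>j < b + 1\<close> unfolding W_def by auto
  moreover have "(int W - 1) * (int b + 1) < int a - 1"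
    using int_a \<open>b \<ge> 4\<close> unfolding W_def by (auto simp: algebra_simps)
  ultimately have "frobenius_number
      [a, h * a + d, h * a + 2 * d, h * a + b * d, h * a + (b + 1) * d] =
    int W * int h * int a + (int a - 1) * int d - int a"
    using assms(1,4,5) by (intro frobenius_number_coins) auto
  \<comment> \<open>Splitting \<open>a d\<close> along the division by \<open>b + 1\<close> turns
    \<open>(a - 1) d\<close> into \<open>Q (b + 1) d + (j - 1) d\<close>; for
    \<open>W = Q + 1\<close> the extra \<open>h a\<close> gives \<open>(h - 1) a\<close>.\<close>
  moreover have "int a * int d = int Q * (int b + 1) * int d + int j * int d"
    by (subst int_a) (simp add: algebra_simps)
  ultimately show ?thesis
    unfolding floor Let_def j_def[symmetric] W_def by (simp add: algebra_simps)
qed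

end
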